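(* Let $(X,d)$ be a metric space, let $f:X\to X$ be a self-mapping, let $u_0\in X$ and $\rho\ge 0$, and let $\theta_\rho:\mathbb{R}\to\mathbb{R}$ be defined by $\theta_\rho(x)=\rho$ if $x=\rho$ and $\theta_\rho(x)=x+\rho$ if $x\ne\rho$. Suppose that (1) there is some $L\in(-\infty,0]$ such that $d(fu,u_0)\le \theta_\rho(d(u,u_0))+L\,d(u,fu)$ for each $u\in X$; (2) $\rho\le d(fu,u_0)$ for each $u\in C_{u_0,\rho}$; (3) $d(fu,fv)\ge 2\rho$ for each $u,v\in C_{u_0,\rho}$ with $u\ne v$; (4) $d(fu,fv)<\rho+d(v,fu)$ for each $u,v\in C_{u_0,\rho}$ with $u\neq v$. Then $f$ fixes the circle $C_{u_0,\rho}$.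
   Context: For a metric space $(X,d)$, $u_0\in X$ and a radius $\rho$, the circle is $C_{u_0,\rho}=\{u\in X: d(u,u_0)=\rho\}$. A self-mapping $f:X\to X$ fixes the circle $C_{u_0,\rho}$ (equivalently, $C_{u_0,\rho}$ is a fixed circle of $f$) if $fu=u$ for all $u\in C_{u_0,\rho}$. Here $fu$ denotes $f(u)$. *)

theory Defs
  imports "HOL-Analysis.Elementary_Metric_Spaces"
begin

text \<open>The circle with centre \<open>u0\<close> and radius \<open>\<rho>\<close> is the library's \<^term>\<open>sphere u0 \<rho>\<close>.\<close>

definition fixes_circle :: "('a::metric_space \<Rightarrow> 'a) \<Rightarrow> 'a \<Rightarrow> real \<Rightarrow> bool" where
  "fixes_circle f u0 \<rho> \<longleftrightarrow> (\<forall>u\<in>sphere u0 \<rho>. f u = u)"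

definition theta :: "real \<Rightarrow> real \<Rightarrow> real" where
  "theta \<rho> x = (if x = \<rho> then \<rho> else x + \<rho>)"

end

(* Conditions (1) and (2) make f map the circle into itself. If f moved a point u of the circle,
   conditions (3) and (4) with v = f u would then give 2 rho <= d(fu, fv) < rho. *)
theory Submission imports Defs
begin

text \<open>The circle is invariant under \<open>f\<close>, so the image of a moved circle point
  \<open>u\<close> may itself serve as the second point \<open>v\<close>. The separation hypotheses
  then bound the same distance below by \<open>2 * \<rho>\<close> and strictly above by
  \<open>\<rho>\<close>, which is absurd for \<open>\<rho> \<ge> 0\<close>.\<close>

theorem theorem2p1:
  fixes f :: "'a::metric_space \<Rightarrow> 'a" and u0 :: 'a and \<rho> :: real
  assumes "\<rho> \<ge> 0"
    and "\<exists>L::real. L \<le> 0 \<and>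
      (\<forall>u. dist (f u) u0 \<le> theta \<rho> (dist u u0) + L * dist u (f u))"
    and "\<forall>u\<in>sphere u0 \<rho>. \<rho> \<le> dist (f u) u0"
    and "\<forall>u\<in>sphere u0 \<rho>. \<forall>v\<in>sphere u0 \<rho>. u \<noteq> v \<longrightarrow> dist (f u) (f v) \<ge> 2 * \<rho>"
    and "\<forall>u\<in>sphere u0 \<rho>. \<forall>v\<in>sphere u0 \<rho>. u \<noteq> v \<longrightarrow> dist (f u) (f v) < \<rho> + dist v (f u)"
  shows "fixes_circle f u0 \<rho>"
proof -
  obtain L where L: "L \<le> 0"
    and f_le: "\<And>u. dist (f u) u0 \<le> theta \<rho> (dist u u0) + L * dist u (f u)"
    using assms(2) by blast
  have "f u = u" if u: "u \<in> sphere u0 \<rho>" for u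
  proof (rule ccontr)
    assume moved: "f u \<noteq> u"
    \<comment> \<open>On the circle the exceptional branch of \<open>theta\<close> applies, giving
      the bound \<open>\<rho>\<close> rather than \<open>2 * \<rho>\<close>.\<close>
    have "theta \<rho> (dist u u0) = \<rho>"
      using u by (simp add: theta_def dist_commute)
    moreover have "L * dist u (f u) \<le> 0"
      using L by (simp add: mult_nonpos_nonneg)
    ultimately have "dist (f u) u0 \<le> \<rho>"
      using f_le[of u] by linarith
    then have fu: "f u \<in> sphere u0 \<rho>"
      using assms(3) u by (force simp: dist_commute)
    \<comment> \<open>The choice \<open>v = f u\<close> makes \<open>dist v (f u)\<close> vanish in
      the strict upper bound.\<close>
    have "2 * \<rho> \<le> dist (f u) (f (f u))"
      using assms(4) u fu moved by metis
    moreover have "dist (f u) (f (f u)) < \<rho> + dist (f u) (f u)"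
      using assms(5) u fu moved by metis
    ultimately show False
      using \<open>\<rho> \<ge> 0\<close> by simp
  qed
  then show ?thesis
    by (simp add: fixes_circle_def)
qed

end
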